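(* Let $P:\mathbb{R}^n\to\mathbb{R}^n$ be a self-adjoint nonexpansive linear operator, let $q\in\mathbb{R}^n$, and let $f_1(x)=\tfrac12\langle Px,x\rangle+\langle q,x\rangle$, so that $\nabla f_1(x)=Px+q$. Let $f_2:\mathbb{R}^n\to\mathbb{R}$ be differentiable with $\nabla f_2$ nonexpansive. Let $F(x)=\tfrac12\langle Px,x\rangle-f_2(\nabla f_1(x))$. If $P$ is positive semidefinite, then $F$ is convex.
   Context: $\langle\cdot,\cdot\rangle$ is an inner product on $\mathbb{R}^n$ with induced norm $\|\cdot\|$; gradients and adjoints are taken with respect to it. A mapping $T:\mathbb{R}^n\to\mathbb{R}^n$ is nonexpansive if $\|Tx-Ty\|\le\|x-y\|$ for all $x,y$. A linear operator is positive semidefinite if it is self-adjoint with all eigenvalues $\geq 0$. *)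

theory Defs
  imports "HOL-Analysis.Analysis"
begin

text \<open>
  Throughout, the type class \<^class>\<open>euclidean_space\<close> plays the role of \<open>\<real>\<^sup>n\<close> with an arbitrary
  inner product: its instances are finite-dimensional real inner product spaces whose norm is the
  induced one.
\<close>

definition nonexpansive :: "('a::real_normed_vector \<Rightarrow> 'a) \<Rightarrow> bool" where
  "nonexpansive T \<longleftrightarrow> (\<forall>x y. norm (T x - T y) \<le> norm (x - y))"

text \<open>The gradient is unique where it exists; at other points the value below is unspecified.\<close>

definition gradient :: "('a::real_inner \<Rightarrow> real) \<Rightarrow> 'a \<Rightarrow> 'a" where
  "gradient f x = (THE d. GDERIV f x :> d)"

definition self_adjoint :: "('a::euclidean_space \<Rightarrow> 'a) \<Rightarrow> bool" where
  "self_adjoint T \<longleftrightarrow> linear T \<and> adjoint T = T"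

definition eigenvalue :: "('a::real_vector \<Rightarrow> 'a) \<Rightarrow> real \<Rightarrow> bool" where
  "eigenvalue T c \<longleftrightarrow> (\<exists>v. v \<noteq> 0 \<and> T v = c *\<^sub>R v)"

text \<open>Only real eigenvalues need to be considered, since a self-adjoint operator has no others.\<close>

definition positive_semidefinite :: "('a::euclidean_space \<Rightarrow> 'a) \<Rightarrow> bool" where
  "positive_semidefinite T \<longleftrightarrow> self_adjoint T \<and> (\<forall>c. eigenvalue T c \<longrightarrow> c \<ge> 0)"

end

theory Submission
  imports Defs
begin

text \<open>
  Since \<open>\<nabla>f\<^sub>2\<close> is nonexpansive, \<open>\<nabla>F x = P x - P (\<nabla>f\<^sub>2 (P x + q))\<close> satisfies
  \<open>(\<nabla>F x - \<nabla>F y) \<bullet> d \<ge> P d \<bullet> d - \<parallel>P d\<parallel>\<^sup>2\<close> with \<open>d = x - y\<close>. Cauchy--Schwarz for the semidefinite form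
  \<open>(x, y) \<mapsto> P x \<bullet> y\<close>, applied to \<open>d\<close> and \<open>P d\<close>, bounds \<open>\<parallel>P d\<parallel>\<^sup>4\<close> by \<open>(P d \<bullet> d) \<parallel>P d\<parallel>\<^sup>2\<close>. So
  \<open>\<nabla>F\<close> is monotone and \<open>F\<close> is convex. That nonnegative eigenvalues make the form semidefinite follows
  by minimising it over the unit sphere.
\<close>

lemma GDERIV_unique:
  assumes "GDERIV f x :> d" "GDERIV f x :> e"
  shows "d = e"
proof -
  have "(\<lambda>h. h \<bullet> d) = (\<lambda>h. h \<bullet> e)"
    using assms has_derivative_unique unfolding gderiv_def by blast
  \<comment> \<open>Both functionals are evaluated at \<open>h = d - e\<close>, which makes
    \<open>d - e\<close> orthogonal to itself.\<close>
  then have "(d - e) \<bullet> d = (d - e) \<bullet> e"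
    by meson
  then show ?thesis
    by (metis inner_diff_right inner_eq_zero_iff right_minus_eq)
qed

lemma gradient_eqI: "GDERIV f x :> d \<Longrightarrow> gradient f x = d"
  unfolding gradient_def using GDERIV_unique by blast

lemma GDERIV_gradient:
  fixes f :: "'a::euclidean_space \<Rightarrow> real"
  assumes "f differentiable (at x)"
  shows "GDERIV f x :> gradient f x"
proof -
  obtain D where D: "(f has_derivative D) (at x)"
    using assms unfolding differentiable_def by blast
  \<comment> \<open>Riesz representation: \<open>D h\<close> is the inner product of
    \<open>D h\<close> and 1 in the reals, and the adjoint moves \<open>D\<close> to the 1.\<close>
  have "D = (\<lambda>h. h \<bullet> adjoint D 1)"
    using adjoint_works[OF has_derivative_linear[OF D], of _ 1] by auto
  with D have "GDERIV f x :> adjoint D 1"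
    unfolding gderiv_def by simp
  then show ?thesis
    using gradient_eqI by metis
qed

lemma self_adjoint_inner:
  assumes "self_adjoint T"
  shows "T x \<bullet> y = x \<bullet> T y"
  using assms adjoint_works unfolding self_adjoint_def by metis

text \<open>The form at \<open>x + t *\<^sub>R y\<close> is a polynomial in \<open>t\<close> of
  degree at most 2 that is never negative.\<close>

lemma self_adjoint_Cauchy_Schwarz:
  assumes "self_adjoint T" and nonneg: "\<And>x. T x \<bullet> x \<ge> 0"
  shows "(T x \<bullet> y)\<^sup>2 \<le> (T x \<bullet> x) * (T y \<bullet> y)"
proof -
  have lin: "linear T"
    using assms(1) self_adjoint_def by blast
  define a b c where "a = T x \<bullet> x" and "b = T x \<bullet> y" and "c = T y \<bullet> y"
  have "T y \<bullet> x = b"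
    using self_adjoint_inner[OF assms(1)] by (simp add: b_def inner_commute)
  then have poly: "0 \<le> a + 2 * t * b + t\<^sup>2 * c" for t
    using nonneg[of "x + t *\<^sub>R y"]
    by (simp add: linear_add[OF lin] linear_scale[OF lin] inner_simps a_def b_def c_def
        power2_eq_square algebra_simps)
  have "b\<^sup>2 \<le> a * c"
  proof (cases "c = 0")
    case True
    then have "b = 0"
      \<comment> \<open>For \<open>c = 0\<close> the polynomial is affine in \<open>t\<close>; if
        \<open>b\<close> were nonzero, it would take the value -1 at this \<open>t\<close>.\<close>
      using poly[of "- (a + 1) / (2 * b)"] by (cases "b = 0") (auto simp: field_simps)
    with True show ?thesis by simp
  next
    case False
    then have "c > 0"
      using nonneg[of y] by (simp add: c_def)
    then show ?thesis
      \<comment> \<open>This \<open>t\<close> is the minimiser, where the polynomial equals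
        \<open>a - b\<^sup>2 / c\<close>.\<close>
      using poly[of "- b / c"] by (simp add: power2_eq_square field_simps)
  qed
  then show ?thesis
    by (simp add: a_def b_def c_def)
qed

text \<open>The minimum \<open>m\<close> of the form on the unit sphere, attained at
  \<open>v\<close>, is an eigenvalue: the form of \<open>S\<close>, which is \<open>T\<close> minus
  \<open>m\<close> times the identity, is nonnegative and vanishes at \<open>v\<close>, which forces
  \<open>S v = 0\<close>.\<close>

lemma positive_semidefinite_inner_nonneg:
  fixes T :: "'a::euclidean_space \<Rightarrow> 'a"
  assumes "positive_semidefinite T"
  shows "T x \<bullet> x \<ge> 0"
proof -
  have sa: "self_adjoint T" and ev: "\<And>c. eigenvalue T c \<Longrightarrow> c \<ge> 0"
    using assms unfolding positive_semidefinite_def by auto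
  then have lin: "linear T"
    using self_adjoint_def by blast
  have "continuous_on (sphere 0 1) (\<lambda>x. T x \<bullet> x)"
    by (intro continuous_intros linear_continuous_on) (use lin in \<open>simp add: linear_linear\<close>)
  then obtain v where v: "norm v = 1" and min: "\<And>u. norm u = 1 \<Longrightarrow> T v \<bullet> v \<le> T u \<bullet> u"
    using continuous_attains_inf[of "sphere (0::'a) 1" "\<lambda>x. T x \<bullet> x"] by auto
  define m where "m = T v \<bullet> v"
  define S where "S = (\<lambda>u. T u - m *\<^sub>R u)"
  have Rayleigh: "m * (u \<bullet> u) \<le> T u \<bullet> u" for u
  proof (cases "u = 0")
    case False
    then have "m \<le> T (u /\<^sub>R norm u) \<bullet> (u /\<^sub>R norm u)"
      unfolding m_def by (intro min) simp
    also have "\<dots> = (T u \<bullet> u) / (u \<bullet> u)"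
      by (simp add: linear_scale[OF lin] dot_square_norm power2_eq_square field_simps)
    finally show ?thesis
      using False by (simp add: field_simps)
  qed (simp add: linear_0[OF lin])
  have "linear S"
    unfolding S_def by (intro linear_compose_sub lin linear_scaleR)
  moreover have "adjoint S = S"
    by (rule adjoint_unique)
      (simp add: S_def inner_diff_left inner_diff_right self_adjoint_inner[OF sa])
  ultimately have saS: "self_adjoint S"
    by (simp add: self_adjoint_def)
  have "S u \<bullet> u \<ge> 0" for u
    using Rayleigh[of u] by (simp add: S_def inner_diff_left)
  moreover have "S v \<bullet> v = 0"
    using v by (simp add: S_def inner_diff_left m_def dot_square_norm)
  \<comment> \<open>Cauchy-Schwarz for the form of \<open>S\<close> at \<open>v\<close> and
    \<open>S v\<close>: the factor \<open>S v \<bullet> v\<close> makes the bound zero.\<close>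
  ultimately have "(S v \<bullet> S v)\<^sup>2 \<le> 0"
    using self_adjoint_Cauchy_Schwarz[OF saS, of v "S v"] by simp
  then have "T v = m *\<^sub>R v"
    by (simp add: S_def)
  then have "m \<ge> 0"
    using v by (intro ev) (auto simp: eigenvalue_def intro!: exI[of _ v])
  then show ?thesis
    using Rayleigh[of x] by (meson inner_ge_zero mult_nonneg_nonneg order_trans)
qed

text \<open>This is firm nonexpansiveness of \<open>T\<close>. Spectrally, the eigenvalues lie in
  [0,1], where squaring does not increase; Cauchy-Schwarz replaces the diagonalisation.\<close>

lemma positive_semidefinite_nonexpansive_norm_le:
  fixes T :: "'a::euclidean_space \<Rightarrow> 'a"
  assumes psd: "positive_semidefinite T" and "nonexpansive T"
  shows "(norm (T x))\<^sup>2 \<le> T x \<bullet> x"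
proof (cases "T x = 0")
  case False
  have sa: "self_adjoint T"
    using psd positive_semidefinite_def by blast
  then have "norm (T y) \<le> norm y" for y
    using \<open>nonexpansive T\<close> linear_0 unfolding nonexpansive_def self_adjoint_def
    by (metis diff_zero)
  then have "T (T x) \<bullet> T x \<le> (norm (T x))\<^sup>2"
    by (metis mult_right_mono norm_cauchy_schwarz norm_ge_zero order_trans power2_eq_square)
  then have "(T x \<bullet> x) * (T (T x) \<bullet> T x) \<le> (T x \<bullet> x) * (norm (T x))\<^sup>2"
    using positive_semidefinite_inner_nonneg[OF psd] by (intro mult_left_mono)
  moreover have "(T x \<bullet> T x)\<^sup>2 \<le> (T x \<bullet> x) * (T (T x) \<bullet> T x)"
    using self_adjoint_Cauchy_Schwarz[OF sa positive_semidefinite_inner_nonneg[OF psd]] .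
  ultimately have "(norm (T x))\<^sup>2 * (norm (T x))\<^sup>2 \<le> (T x \<bullet> x) * (norm (T x))\<^sup>2"
    by (simp add: dot_square_norm power2_eq_square)
  then show ?thesis
    using False by (simp add: power2_eq_square)
qed simp

text \<open>On each line, monotonicity of \<open>g\<close> makes the derivative of the restriction
  \<phi> nondecreasing, which reduces the claim to one real variable.\<close>

lemma convex_on_monotone_GDERIV:
  fixes f :: "'a::real_inner \<Rightarrow> real"
  assumes deriv: "\<And>x. GDERIV f x :> g x"
    and mono: "\<And>x y. (g x - g y) \<bullet> (x - y) \<ge> 0"
  shows "convex_on UNIV f"
proof (rule convex_onI)
  fix t :: real and x y :: 'a
  assume t: "0 < t" "t < 1"
  define d where "d = y - x"
  define \<phi> where "\<phi> = (\<lambda>s. f (x + s *\<^sub>R d))"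
  have "convex_on UNIV \<phi>"
  proof (rule convex_on_realI)
    fix s :: real
    have "((\<lambda>s. x + s *\<^sub>R d) has_derivative (\<lambda>h. h *\<^sub>R d)) (at s)"
      by (auto intro!: derivative_eq_intros)
    from has_derivative_compose[OF this deriv[unfolded gderiv_def]]
    show "(\<phi> has_real_derivative g (x + s *\<^sub>R d) \<bullet> d) (at s)"
      by (simp add: \<phi>_def has_field_derivative_def inner_commute[of _ d] mult_commute_abs)
  next
    fix r s :: real
    assume "r \<le> s"
    \<comment> \<open>The two points differ by \<open>(s - r) *\<^sub>R d\<close>; the positive
      factor \<open>s - r\<close> is then cancelled, with \<open>r = s\<close> treated
      apart.\<close>
    have "0 \<le> (s - r) * ((g (x + s *\<^sub>R d) - g (x + r *\<^sub>R d)) \<bullet> d)"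
      using mono[of "x + s *\<^sub>R d" "x + r *\<^sub>R d"] by (simp flip: scaleR_left_diff_distrib)
    with \<open>r \<le> s\<close> show "g (x + r *\<^sub>R d) \<bullet> d \<le> g (x + s *\<^sub>R d) \<bullet> d"
      by (cases "r = s") (auto simp: zero_le_mult_iff inner_diff_left)
  qed simp
  then have "\<phi> ((1 - t) *\<^sub>R 0 + t *\<^sub>R 1) \<le> (1 - t) * \<phi> 0 + t * \<phi> 1"
    using t by (intro convex_onD) auto
  then show "f ((1 - t) *\<^sub>R x + t *\<^sub>R y) \<le> (1 - t) * f x + t * f y"
    by (simp add: \<phi>_def d_def algebra_simps)
qed simp

lemma GDERIV_quadratic:
  assumes sa: "self_adjoint T"
  shows "GDERIV (\<lambda>x. (1/2) * (T x \<bullet> x)) x :> T x"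
proof -
  have "(T has_derivative T) (at x)"
    using sa by (simp add: self_adjoint_def linear_imp_has_derivative)
  then have "((\<lambda>x. (1/2) * (T x \<bullet> x)) has_derivative (\<lambda>h. (1/2) * (T x \<bullet> h + T h \<bullet> x))) (at x)"
    by (intro has_derivative_mult_right has_derivative_inner has_derivative_ident)
  \<comment> \<open>Self-adjointness makes the two terms of the product rule equal, which absorbs
    the factor 1/2.\<close>
  moreover have "(\<lambda>h. (1/2) * (T x \<bullet> h + T h \<bullet> x)) = (\<lambda>h. h \<bullet> T x)"
    by (simp add: self_adjoint_inner[OF sa, of _ x] inner_commute[of "T x"])
  ultimately show ?thesis
    by (simp add: gderiv_def)
qed

theorem proposition3p2:
  fixes P :: "'a::euclidean_space \<Rightarrow> 'a" and q :: 'a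
    and f1 f2 F :: "'a \<Rightarrow> real"
  assumes "linear P" and "self_adjoint P" and "nonexpansive P"
    and f1: "\<And>x. f1 x = (1/2) * (P x \<bullet> x) + q \<bullet> x"
    and "\<And>x. f2 differentiable (at x)" and "nonexpansive (gradient f2)"
    and F: "\<And>x. F x = (1/2) * (P x \<bullet> x) - f2 (gradient f1 x)"
  shows "(\<forall>x. GDERIV f1 x :> P x + q) \<and>
         (positive_semidefinite P \<longrightarrow> convex_on UNIV F)"
proof -
  note quadratic = GDERIV_quadratic[OF \<open>self_adjoint P\<close>]
  have "GDERIV (\<lambda>x. q \<bullet> x) x :> q" for x
    by (auto simp: gderiv_def inner_commute intro!: derivative_eq_intros)
  then have f1_deriv: "GDERIV f1 x :> P x + q" for x
    using GDERIV_add[OF quadratic] by (simp add: f1[abs_def])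
  have F': "F = (\<lambda>x. (1/2) * (P x \<bullet> x) - f2 (P x + q))"
    using F gradient_eqI[OF f1_deriv] by auto
  define g where "g = (\<lambda>x. gradient f2 (P x + q))"
  \<comment> \<open>The chain rule gives the derivative \<open>P h \<bullet> g x\<close>;
    self-adjointness moves \<open>P\<close> onto \<open>g x\<close>.\<close>
  have "GDERIV (\<lambda>x. f2 (P x + q)) x :> P (g x)" for x
  proof -
    have "((\<lambda>x. P x + q) has_derivative P) (at x)"
      by (intro has_derivative_add_const linear_imp_has_derivative \<open>linear P\<close>)
    from has_derivative_compose[OF this
        GDERIV_gradient[OF assms(5), unfolded gderiv_def]]
    show ?thesis
      by (simp add: gderiv_def g_def self_adjoint_inner[OF \<open>self_adjoint P\<close>])
  qed
  then have F_deriv: "GDERIV F x :> P x - P (g x)" for x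
    using GDERIV_diff[OF quadratic] by (simp add: F')
  have "convex_on UNIV F" if psd: "positive_semidefinite P"
  proof (rule convex_on_monotone_GDERIV[OF F_deriv])
    fix x y :: 'a
    define d where "d = x - y"
    have Pd: "P x - P y = P d"
      by (simp add: d_def linear_diff[OF \<open>linear P\<close>])
    \<comment> \<open>The shift \<open>q\<close> cancels in the difference of the two arguments of
      \<open>gradient f2\<close>.\<close>
    have "norm (g x - g y) \<le> norm (P d)"
      using \<open>nonexpansive (gradient f2)\<close> unfolding nonexpansive_def g_def Pd[symmetric]
      by (metis add_diff_cancel_right)
    then have "(g x - g y) \<bullet> P d \<le> (norm (P d))\<^sup>2"
      by (metis mult_right_mono norm_cauchy_schwarz norm_ge_zero order_trans power2_eq_square)
    also have "\<dots> \<le> P d \<bullet> d"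
      using positive_semidefinite_nonexpansive_norm_le[OF psd \<open>nonexpansive P\<close>] .
    also have "(g x - g y) \<bullet> P d = (P (g x) - P (g y)) \<bullet> d"
      by (simp add: self_adjoint_inner[OF \<open>self_adjoint P\<close>] flip: linear_diff[OF \<open>linear P\<close>])
    finally show "(P x - P (g x) - (P y - P (g y))) \<bullet> (x - y) \<ge> 0"
      by (simp add: d_def linear_diff[OF \<open>linear P\<close>] inner_diff_left)
  qed
  with f1_deriv show ?thesis
    by blast
qed

end
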